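(* Consider the linear program of minimizing $$f^{\mathrm{inv}}(u^{\mathrm{inv}})+\sum_{t\in\mathcal T}\left(C^{\mathrm p}p_t+C^{\mathrm{nl}}u_t\right)+\sum_{t\in\mathcal T^0}\left(C^{\mathrm{su}}v_t+C^{\mathrm{sd}}w_t\right)$$ over all real $(p,u,v,w)\in\mathbb R^{\mathcal T}\times\mathbb R^{\mathcal T}\times\mathbb R^{\mathcal T^0}\times\mathbb R^{\mathcal T^0}$ satisfying $$\underline P\,u_t\le p_t\le\overline P\,u_t,\quad p_t\ge 0,\quad 0\le u_t\le 1\qquad\forall t\in\mathcal T,$$ $$u_t-u_{t-1}=v_t-w_t,\quad 0\le v_t\le 1,\quad 0\le w_t\le 1\qquad\forall t\in\mathcal T^0,$$ $$v_t\le u_t\qquad\forall t\in\mathcal T^0,\tag{a}$$ $$w_t\le 1-u_t\qquad\forall t\in\mathcal T^0.\tag{b}$$ If $C^{\mathrm{su}}>0$ and $C^{\mathrm{sd}}>0$, then constraints (a) and (b) are redundant in this linear program with this objective: every optimal solution of the linear program obtained by deleting (a) and (b) satisfies (a) and (b), so deleting (a) and (b) does not change the set of optimal solutions.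
   Context: Single-unit unit commitment problem (no demand balance constraint). $\mathcal T=\{t_0,t_0+1,\dots,t_{end}\}$ is a finite set of consecutive time periods and $\mathcal T^0=\mathcal T\setminus\{t_0\}$. $0\le\underline P\le\overline P$ are the minimum and maximum output; $C^{\mathrm p},C^{\mathrm{nl}},C^{\mathrm{su}},C^{\mathrm{sd}}$ are the nonnegative production, non-load, start-up and shut-down costs. The variables $p_t,u_t,v_t,w_t$ are production, commitment status, start-up and shut-down in period $t$. The investment variable $u^{\mathrm{inv}}$ does not occur in the constraints of this (operational) model, so the term $f^{\mathrm{inv}}(u^{\mathrm{inv}})$ is a constant. The linear program is the LP relaxation of the model ("Model II") in which $u_t,v_t,w_t\in\{0,1\}$. *)

theory Defs
  imports Complex_Main "HOL-Library.FuncSet"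
begin

text \<open>
  Periods are integers. A vector indexed by a set of periods is a function that is extensional on
  that set (undefined outside it), so that equality of sets of solutions is not affected by values
  at irrelevant indices.
\<close>

definition periods :: "int \<Rightarrow> int \<Rightarrow> int set" where
  "periods t0 tend = {t0..tend}"

definition periods0 :: "int \<Rightarrow> int \<Rightarrow> int set" where
  "periods0 t0 tend = periods t0 tend - {t0}"

text \<open>A solution is a quadruple \<open>(p, u, v, w)\<close>.\<close>

type_synonym uc_solution =
  "(int \<Rightarrow> real) \<times> (int \<Rightarrow> real) \<times> (int \<Rightarrow> real) \<times> (int \<Rightarrow> real)"

definition uc_space :: "int \<Rightarrow> int \<Rightarrow> uc_solution set" where
  "uc_space t0 tend =
     (periods t0 tend \<rightarrow>\<^sub>E UNIV) \<times> (periods t0 tend \<rightarrow>\<^sub>E UNIV) \<times>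
     (periods0 t0 tend \<rightarrow>\<^sub>E UNIV) \<times> (periods0 t0 tend \<rightarrow>\<^sub>E UNIV)"

fun uc_cost ::
  "int \<Rightarrow> int \<Rightarrow> real \<Rightarrow> real \<Rightarrow> real \<Rightarrow> real \<Rightarrow> real \<Rightarrow> uc_solution \<Rightarrow> real" where
  "uc_cost t0 tend inv_cost Cp Cnl Csu Csd (p, u, v, w) =
     inv_cost
     + (\<Sum>t\<in>periods t0 tend. Cp * p t + Cnl * u t)
     + (\<Sum>t\<in>periods0 t0 tend. Csu * v t + Csd * w t)"

definition startup_constraint :: "int \<Rightarrow> int \<Rightarrow> uc_solution \<Rightarrow> bool" where
  "startup_constraint t0 tend = (\<lambda>(p, u, v, w). \<forall>t\<in>periods0 t0 tend. v t \<le> u t)"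

definition shutdown_constraint :: "int \<Rightarrow> int \<Rightarrow> uc_solution \<Rightarrow> bool" where
  "shutdown_constraint t0 tend = (\<lambda>(p, u, v, w). \<forall>t\<in>periods0 t0 tend. w t \<le> 1 - u t)"

text \<open>Feasible set of the linear program without the start-up and shut-down constraints above.\<close>

definition reduced_feasible :: "int \<Rightarrow> int \<Rightarrow> real \<Rightarrow> real \<Rightarrow> uc_solution set" where
  "reduced_feasible t0 tend Pmin Pmax =
     {(p, u, v, w) \<in> uc_space t0 tend.
        (\<forall>t\<in>periods t0 tend.
           Pmin * u t \<le> p t \<and> p t \<le> Pmax * u t \<and> 0 \<le> p t \<and> 0 \<le> u t \<and> u t \<le> 1) \<and>
        (\<forall>t\<in>periods0 t0 tend.
           u t - u (t - 1) = v t - w t \<and>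
           0 \<le> v t \<and> v t \<le> 1 \<and> 0 \<le> w t \<and> w t \<le> 1)}"

definition full_feasible :: "int \<Rightarrow> int \<Rightarrow> real \<Rightarrow> real \<Rightarrow> uc_solution set" where
  "full_feasible t0 tend Pmin Pmax =
     {x \<in> reduced_feasible t0 tend Pmin Pmax.
        startup_constraint t0 tend x \<and> shutdown_constraint t0 tend x}"

definition optimal_solutions :: "('a \<Rightarrow> real) \<Rightarrow> 'a set \<Rightarrow> 'a set" where
  "optimal_solutions f S = {x. is_arg_min f (\<lambda>y. y \<in> S) x}"

end

theory Submission imports Defs begin

text \<open>
  Lowering \<open>v\<^sub>t\<close> and \<open>w\<^sub>t\<close> by their common part \<open>min v\<^sub>t w\<^sub>t\<close> keeps \<open>v\<^sub>t - w\<^sub>t = u\<^sub>t - u\<^sub>t\<^sub>-\<^sub>1\<close>, and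
  leaves at most one of the two positive: \<open>v\<^sub>t\<close> becomes the positive part and \<open>w\<^sub>t\<close> the negative
  part of \<open>u\<^sub>t - u\<^sub>t\<^sub>-\<^sub>1\<close>. As \<open>0 \<le> u \<le> 1\<close>, these parts are at most \<open>u\<^sub>t\<close> and \<open>1 - u\<^sub>t\<close>, so the result
  satisfies (a) and (b) (lemma \<open>net_switching_full_feasible\<close>). The cost drops by \<open>Csu + Csd\<close> for
  each unit removed, so it drops strictly unless nothing is removed
  (lemmas \<open>uc_cost_net_switching\<close> and \<open>net_switching_eqI\<close>).

  Thus there is a map of the reduced feasible set into the full one that strictly improves every
  point it moves. It fixes every optimal solution of the reduced program, which therefore lies in
  the full feasible set, and it shows that a solution optimal in the full program is not beaten in
  the reduced one (lemma \<open>optimal_solutions_improving_map\<close>).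
\<close>

text \<open>
  A point of \<open>R\<close> that \<open>r\<close> moves is beaten by its image, so optimal points are fixed and lie in
  \<open>S\<close>. Conversely, every value of \<open>f\<close> on \<open>R\<close> is bounded below by a value on \<open>S\<close>, namely the one
  at the image. This comparison is pointwise, so it is valid whether or not a minimum is attained.
\<close>

lemma optimal_solutions_improving_map:
  assumes "S \<subseteq> R"
    and into: "\<And>x. x \<in> R \<Longrightarrow> r x \<in> S"
    and improves: "\<And>x. x \<in> R \<Longrightarrow> r x \<noteq> x \<Longrightarrow> f (r x) < f x"
  shows "optimal_solutions f R \<subseteq> S" and "optimal_solutions f R = optimal_solutions f S"
proof -
  show sub: "optimal_solutions f R \<subseteq> S"
  proof
    fix x assume "x \<in> optimal_solutions f R"
    then have x: "x \<in> R" "\<And>y. y \<in> R \<Longrightarrow> \<not> f y < f x"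
      by (auto simp: optimal_solutions_def is_arg_min_def)
    then have "r x = x"
      using improves into \<open>S \<subseteq> R\<close> by blast
    then show "x \<in> S"
      using into[OF x(1)] by simp
  qed
  have "optimal_solutions f S \<subseteq> optimal_solutions f R"
  proof
    fix x assume "x \<in> optimal_solutions f S"
    then have x: "x \<in> S" "\<And>y. y \<in> S \<Longrightarrow> f x \<le> f y"
      by (auto simp: optimal_solutions_def is_arg_min_def not_less)
    have "f x \<le> f y" if "y \<in> R" for y
      using x(2)[OF into[OF that]] improves[OF that] by (cases "r y = y") auto
    then show "x \<in> optimal_solutions f R"
      using x(1) \<open>S \<subseteq> R\<close> by (auto simp: optimal_solutions_def is_arg_min_def not_less)
  qed
  with sub \<open>S \<subseteq> R\<close> show "optimal_solutions f R = optimal_solutions f S"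
    by (auto simp: optimal_solutions_def is_arg_min_def)
qed

text \<open>
  Restricting to the index set keeps the new vectors extensional, so that the result is again a
  point of the space of solutions.
\<close>

fun net_switching :: "int \<Rightarrow> int \<Rightarrow> uc_solution \<Rightarrow> uc_solution" where
  "net_switching t0 tend (p, u, v, w) =
     (p, u, restrict (\<lambda>t. v t - min (v t) (w t)) (periods0 t0 tend),
            restrict (\<lambda>t. w t - min (v t) (w t)) (periods0 t0 tend))"

lemma net_switching_full_feasible:
  assumes "x \<in> reduced_feasible t0 tend Pmin Pmax"
  shows "net_switching t0 tend x \<in> full_feasible t0 tend Pmin Pmax"
proof -
  obtain p u v w where x: "x = (p, u, v, w)" by (cases x)
  have u: "0 \<le> u t" "u t \<le> 1" if "t \<in> periods t0 tend" for t
    using assms that by (auto simp: x reduced_feasible_def)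
  have vw: "u t - u (t - 1) = v t - w t" "0 \<le> v t" "v t \<le> 1" "0 \<le> w t" "w t \<le> 1"
    if "t \<in> periods0 t0 tend" for t
    using assms that by (auto simp: x reduced_feasible_def)
  have idx: "t \<in> periods t0 tend" "t - 1 \<in> periods t0 tend" if "t \<in> periods0 t0 tend" for t
    using that by (auto simp: periods_def periods0_def)
  have "v t - min (v t) (w t) \<le> u t" "w t - min (v t) (w t) \<le> 1 - u t"
    if "t \<in> periods0 t0 tend" for t
    using vw(1)[OF that] u[OF idx(1)[OF that]] u[OF idx(2)[OF that]] by linarith+
  moreover have "v t - min (v t) (w t) \<le> 1" "w t - min (v t) (w t) \<le> 1"
    if "t \<in> periods0 t0 tend" for t
    using vw(2-5)[OF that] by linarith+
  then have "net_switching t0 tend x \<in> reduced_feasible t0 tend Pmin Pmax"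
    using assms by (auto simp: x reduced_feasible_def uc_space_def)
  ultimately show ?thesis
    by (auto simp: x full_feasible_def startup_constraint_def shutdown_constraint_def)
qed

lemma uc_cost_net_switching:
  "uc_cost t0 tend c Cp Cnl Csu Csd (net_switching t0 tend (p, u, v, w)) =
   uc_cost t0 tend c Cp Cnl Csu Csd (p, u, v, w)
     - (Csu + Csd) * (\<Sum>t\<in>periods0 t0 tend. min (v t) (w t))"
proof -
  have "(\<Sum>t\<in>periods0 t0 tend. Csu * (v t - min (v t) (w t)) + Csd * (w t - min (v t) (w t))) =
        (\<Sum>t\<in>periods0 t0 tend. (Csu * v t + Csd * w t) - (Csu + Csd) * min (v t) (w t))"
    by (rule sum.cong) (auto simp: algebra_simps)
  then show ?thesis
    by (simp add: sum_subtractf sum_distrib_left)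
qed

lemma net_switching_eqI:
  assumes "(p, u, v, w) \<in> uc_space t0 tend"
    and "\<And>t. t \<in> periods0 t0 tend \<Longrightarrow> min (v t) (w t) = 0"
  shows "net_switching t0 tend (p, u, v, w) = (p, u, v, w)"
  using assms by (auto simp: uc_space_def PiE_def extensional_def restrict_def fun_eq_iff)

lemma net_switching_improves:
  assumes x: "x \<in> reduced_feasible t0 tend Pmin Pmax"
    and moved: "net_switching t0 tend x \<noteq> x"
    and "0 < Csu" and "0 < Csd"
  shows "uc_cost t0 tend c Cp Cnl Csu Csd (net_switching t0 tend x)
       < uc_cost t0 tend c Cp Cnl Csu Csd x"
proof -
  obtain p u v w where eq: "x = (p, u, v, w)" by (cases x)
  have nonneg: "0 \<le> min (v t) (w t)" if "t \<in> periods0 t0 tend" for t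
    using x that by (auto simp: eq reduced_feasible_def)
  have "x \<in> uc_space t0 tend"
    using x by (auto simp: reduced_feasible_def)
  then obtain s where "s \<in> periods0 t0 tend" "min (v s) (w s) \<noteq> 0"
    using moved net_switching_eqI eq by blast
  with nonneg[of s] have s: "s \<in> periods0 t0 tend" "0 < min (v s) (w s)"
    by linarith+
  have "finite (periods0 t0 tend)"
    by (simp add: periods_def periods0_def)
  then have "0 < (\<Sum>t\<in>periods0 t0 tend. min (v t) (w t))"
    using s nonneg by (rule sum_pos2)
  then have "0 < (Csu + Csd) * (\<Sum>t\<in>periods0 t0 tend. min (v t) (w t))"
    using \<open>0 < Csu\<close> \<open>0 < Csd\<close> by (intro mult_pos_pos) auto
  then show ?thesis
    unfolding eq uc_cost_net_switching by linarith
qed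

theorem mainTheorem2:
  fixes t0 tend :: int
    and Pmin Pmax Cp Cnl Csu Csd :: real
    and finv :: "'i \<Rightarrow> real" and uinv :: 'i
  assumes "t0 \<le> tend"
    and "0 \<le> Pmin" and "Pmin \<le> Pmax"
    and "0 \<le> Cp" and "0 \<le> Cnl"
    and "0 < Csu" and "0 < Csd"
  defines "cost \<equiv> uc_cost t0 tend (finv uinv) Cp Cnl Csu Csd"
  shows "(\<forall>x \<in> optimal_solutions cost (reduced_feasible t0 tend Pmin Pmax).
            startup_constraint t0 tend x \<and> shutdown_constraint t0 tend x) \<and>
         optimal_solutions cost (reduced_feasible t0 tend Pmin Pmax) =
         optimal_solutions cost (full_feasible t0 tend Pmin Pmax)"
proof -
  let ?R = "reduced_feasible t0 tend Pmin Pmax" and ?S = "full_feasible t0 tend Pmin Pmax"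
  have sub: "?S \<subseteq> ?R"
    by (auto simp: full_feasible_def)
  have into: "net_switching t0 tend x \<in> ?S" if "x \<in> ?R" for x
    using that by (rule net_switching_full_feasible)
  have improves: "cost (net_switching t0 tend x) < cost x"
    if "x \<in> ?R" "net_switching t0 tend x \<noteq> x" for x
    unfolding cost_def using that \<open>0 < Csu\<close> \<open>0 < Csd\<close> by (rule net_switching_improves)
  have "optimal_solutions cost ?R \<subseteq> ?S" "optimal_solutions cost ?R = optimal_solutions cost ?S"
    using optimal_solutions_improving_map[where r = "net_switching t0 tend" and f = cost, OF sub into improves]
    by blast+
  then show ?thesis
    by (auto simp: full_feasible_def)
qed

end
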